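(* Let $w$ be a recurrent infinite word, and let $\sigma=(j_1\,j_2\,\ldots\,j_m)$ be a cycle of length $m$ (with $j_1,\dots,j_m$ pairwise distinct positive integers) which is not arithmetical. Suppose there exist increasing sequences of integers $(n_k)_{k\geq 1}$ and $(i_k)_{k\geq 1}$ such that for each $k$ there exists $\beta_{n_k}\in G_{n_k}(w)$ with $\beta_{n_k}(i_k+j_1)=i_k+j_2$, $\beta_{n_k}(i_k+j_2)=i_k+j_3$, \dots, $\beta_{n_k}(i_k+j_m)=i_k+j_1$, and $\beta_{n_k}(t)=t$ for each $t=1,\dots,i_k+\min_{1\leq l\leq m}j_l-1$. Then the word $w$ is universal.
   Context: An infinite word is a one-sided sequence $w=w_1w_2\cdots$ of letters from a finite alphabet. $F(w)$ denotes the set of all (finite) factors of $w$ and $F_n(w)$ the set of factors of length $n$. The word $w$ is recurrent if each of its factors occurs infinitely often in $w$. A permutation $g\in S_n$ acts on a word $u=u_1\cdots u_n$ by $g(u)=u_{g^{-1}(1)}\cdots u_{g^{-1}(n)}$. The symmetry group of order $n$ of $w$ is $G_n(w)=\{\pi\in S_n \mid \pi(x)\in F_n(w)\text{ for each }x\in F_n(w)\}$. A cycle $(j_1\,j_2\,\ldots\,j_m)$ is arithmetical if there exists an integer $l\geq 2$ such that $j_1\equiv j_2\equiv\cdots\equiv j_m\pmod l$. It is implicit that all the indices $i_k+j_l$ lie in $\{1,\dots,n_k\}$. The word $w$ is universal if $F(w)=\Sigma^*$, where $\Sigma$ is the set of letters occurring in $w$. *)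

theory Defs
  imports
    "HOL-Library.Omega_Words_Fun"
    "HOL-Combinatorics.Permutations"
    "HOL-Number_Theory.Cong"
begin

text \<open>
  The letter written $w_p$ in 1-based notation is \<open>w (p - 1)\<close> here, so a factor of length \<open>n\<close>
  is a word \<open>w [p \<rightarrow> p + n]\<close> with \<open>p :: nat\<close>. The letters occurring in \<open>w\<close> form the set \<open>range w\<close>.
\<close>

definition factors_of_length :: "nat \<Rightarrow> 'a word \<Rightarrow> 'a list set" where
  "factors_of_length n w = {w [p \<rightarrow> p + n] | p. True}"

definition factors :: "'a word \<Rightarrow> 'a list set" where
  "factors w = (\<Union>n. factors_of_length n w)"

definition recurrent :: "'a word \<Rightarrow> bool" where
  "recurrent w \<longleftrightarrow> (\<forall>u \<in> factors w. infinite {p. w [p \<rightarrow> p + length u] = u})"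

definition universal :: "'a word \<Rightarrow> bool" where
  "universal w \<longleftrightarrow> factors w = lists (range w)"

text \<open>
  Positions in a finite word are the integers \<open>1, \<dots>, n\<close>, so an element of $S_n$ is a function
  on \<open>int\<close> that permutes \<open>{1..int n}\<close>. Integers rather than naturals are used so that positions
  \<open>i + j\<close> with a possibly negative offset \<open>i\<close> need no coercions. List positions start at 0,
  hence the index shift in \<open>perm_word\<close>.
\<close>

definition perm_word :: "(int \<Rightarrow> int) \<Rightarrow> 'a list \<Rightarrow> 'a list" where
  "perm_word g u = map (\<lambda>t. u ! nat (inv g t - 1)) [1..int (length u)]"

definition symmetry_group :: "nat \<Rightarrow> 'a word \<Rightarrow> (int \<Rightarrow> int) set" where
  "symmetry_group n w = {g. g permutes {1..int n} \<and>
     (\<forall>x \<in> factors_of_length n w. perm_word g x \<in> factors_of_length n w)}"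

text \<open>The cycle $(j_1\,j_2\,\ldots\,j_m)$ is given by the list of its entries.\<close>

definition arithmetical :: "int list \<Rightarrow> bool" where
  "arithmetical js \<longleftrightarrow> (\<exists>l\<ge>2. \<forall>x \<in> set js. \<forall>y \<in> set js. [x = y] (mod l))"

end

theory Submission
  imports Defs
begin

text \<open>
  Call a gap \<open>e\<close> skippable if, whenever \<open>u z c\<close> is a factor with \<open>|z| = e\<close>, so is \<open>u c\<close>.
  Skippable gaps are closed under addition. Iterating the symmetry whose cycle starts right after
  (a long left extension of) \<open>u\<close> shows that all differences between an entry of the cycle and its
  least entry are skippable. As the cycle is not arithmetical, these differences have gcd 1, so all
  large gaps are skippable. By recurrence every letter occurs at arbitrarily large distance
  after every factor, hence every factor can be prolonged by every letter.
\<close>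

definition skippable :: "'a word \<Rightarrow> nat \<Rightarrow> bool" where
  "skippable w e \<longleftrightarrow>
     (\<forall>p L. \<exists>q. (\<forall>r<L. w (q + r) = w (p + r)) \<and> w (q + L) = w (p + L + e))"

lemma skippable_0: "skippable w 0"
  unfolding skippable_def by auto

text \<open>The gap is removed in two stages: first its last \<open>b\<close> letters, with its
  first \<open>a\<close> letters counted as part of the prefix, then those \<open>a\<close>
  letters.\<close>

lemma skippable_add:
  assumes "skippable w a" "skippable w b"
  shows "skippable w (a + b)"
  unfolding skippable_def
proof (intro allI)
  fix p L
  obtain q where q: "\<And>r. r < L + a \<Longrightarrow> w (q + r) = w (p + r)" "w (q + (L + a)) = w (p + (L + a) + b)"
    using assms(2) unfolding skippable_def by meson
  obtain q' where q': "\<And>r. r < L \<Longrightarrow> w (q' + r) = w (q + r)" "w (q' + L) = w (q + L + a)"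
    using assms(1) unfolding skippable_def by meson
  show "\<exists>q. (\<forall>r<L. w (q + r) = w (p + r)) \<and> w (q + L) = w (p + L + (a + b))"
    using q q' by (intro exI[of _ q']) (simp add: add.assoc)
qed

section \<open>Numerical semigroups\<close>

text \<open>The least positive difference \<open>g\<close> of two elements of \<open>A\<close>
  divides every element, so it is 1. The consecutive elements \<open>x\<close> and
  \<open>x + 1\<close> then generate every number from \<open>x * x\<close> on.\<close>

lemma numerical_semigroup_cofinite:
  fixes A :: "nat set"
  assumes zero: "0 \<in> A" and add: "\<And>a b. a \<in> A \<Longrightarrow> b \<in> A \<Longrightarrow> a + b \<in> A"
    and gcd: "\<And>g. (\<And>a. a \<in> A \<Longrightarrow> g dvd a) \<Longrightarrow> g = 1"
  shows "\<exists>N. \<forall>e\<ge>N. e \<in> A"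
proof -
  have mult: "k * a \<in> A" if "a \<in> A" for k a
    by (induction k) (use that zero add in auto)
  define D where "D g \<longleftrightarrow> g > 0 \<and> (\<exists>x\<in>A. x + g \<in> A)" for g
  define g where "g = (LEAST g. D g)"
  \<comment> \<open>The common divisor 0 would divide only 0, so \<open>A = {0}\<close> is ruled
    out.\<close>
  obtain a where "a \<in> A" "a \<noteq> 0"
    using gcd[of 0] by auto
  then have "D a"
    using zero by (auto simp: D_def intro!: bexI[of _ 0])
  then have Dg: "D g"
    unfolding g_def by (rule LeastI)
  then obtain x where x: "x \<in> A" "x + g \<in> A" and "g > 0"
    by (auto simp: D_def)
  have "g dvd a" if a: "a \<in> A" for a
  proof (rule ccontr)
    assume "\<not> g dvd a"
    then have r: "0 < a mod g" "a mod g < g"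
      using \<open>g > 0\<close> by (auto simp: dvd_eq_mod_eq_0)
    \<comment> \<open>This exhibits \<open>a mod g\<close> as a smaller positive difference of two
      elements of \<open>A\<close>.\<close>
    have "a div g * (x + g) + a mod g = a + a div g * x"
      by (simp add: algebra_simps)
    also have "\<dots> \<in> A"
      using a x mult add by blast
    finally have "D (a mod g)"
      using r mult[OF x(2)] by (auto simp: D_def)
    then show False
      using r not_less_Least[of "a mod g" D] by (simp add: g_def)
  qed
  then have "g = 1"
    by (rule gcd)
  have "e \<in> A" if "e \<ge> x * x" for e
  proof (cases "x = 0")
    case True
    then show ?thesis
      using mult[of "x + g" e] x \<open>g = 1\<close> True by simp
  next
    case False
    then have "x \<le> e div x"
      using that by (simp add: less_eq_div_iff_mult_less_eq)
    moreover have "e mod x < x"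
      using False by simp
    ultimately have le: "e mod x \<le> e div x"
      by linarith
    \<comment> \<open>Of the \<open>e div x\<close> summands \<open>x\<close> of \<open>e\<close>,
      as many as \<open>e mod x\<close> are raised to \<open>x + 1\<close>; by \<open>le\<close>
      there are enough of them.\<close>
    have "(e div x - e mod x) * x + e mod x * (x + 1) =
        (e div x - e mod x + e mod x) * x + e mod x"
      by (simp only: algebra_simps)
    also have "\<dots> = e"
      using le by simp
    finally have "(e div x - e mod x) * x + e mod x * (x + 1) = e" .
    moreover have "(e div x - e mod x) * x + e mod x * (x + 1) \<in> A"
      by (rule add; rule mult) (use x \<open>g = 1\<close> in auto)
    ultimately show ?thesis by simp
  qed
  then show ?thesis by blast
qed

section \<open>Recurrence and universality\<close>

lemma factor_iff: "x \<in> factors w \<longleftrightarrow> (\<exists>p. x = w [p \<rightarrow> p + length x])"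
  unfolding factors_def factors_of_length_def
  by (auto simp: subsequence_length)

lemma recurrentD:
  assumes "recurrent w"
  shows "\<exists>q\<ge>M. \<forall>r<L. w (q + r) = w (p + r)"
proof -
  have "w [p \<rightarrow> p + L] \<in> factors w"
    by (auto simp: factor_iff subsequence_length)
  then have "infinite {q. w [q \<rightarrow> q + L] = w [p \<rightarrow> p + L]}"
    using assms unfolding recurrent_def by (fastforce simp: subsequence_length)
  then obtain q where q: "q \<ge> M" "w [q \<rightarrow> q + L] = w [p \<rightarrow> p + L]"
    unfolding infinite_nat_iff_unbounded_le by auto
  have "w (q + r) = w (p + r)" if "r < L" for r
    using arg_cong[OF q(2), of "\<lambda>u. u ! r"] that by simp
  with q(1) show ?thesis by blast
qed

lemma universal_if_skippable:
  assumes "recurrent w" and skip: "\<And>e. e \<ge> N \<Longrightarrow> skippable w e"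
  shows "universal w"
proof -
  have "x \<in> factors w" if "x \<in> lists (range w)" for x
    using that
  proof (induction x rule: rev_induct)
    case Nil
    then show ?case by (simp add: factor_iff subsequence_def)
  next
    case (snoc c u)
    then have "u \<in> factors w" by simp
    then obtain p where u: "u = w [p \<rightarrow> p + length u]"
      by (auto simp: factor_iff)
    obtain s where c: "c = w s"
      using snoc.prems by auto
    \<comment> \<open>Recurrence of the one-letter factor at \<open>s\<close> yields an occurrence
      of \<open>c\<close> far enough behind \<open>u\<close>.\<close>
    obtain t where t: "t \<ge> p + length u + N" "w t = c"
      using recurrentD[OF assms(1), of "p + length u + N" 1 s] c by auto
    define e where "e = t - (p + length u)"
    have "e \<ge> N" "p + length u + e = t"
      using t(1) by (auto simp: e_def)
    then obtain q where q: "\<And>r. r < length u \<Longrightarrow> w (q + r) = w (p + r)" "w (q + length u) = c"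
      using skip[of e] t(2) unfolding skippable_def by metis
    have ur: "u ! r = w (p + r)" if "r < length u" for r
      using arg_cong[OF u, of "\<lambda>v. v ! r"] that by simp
    have "u @ [c] = w [q \<rightarrow> q + length (u @ [c])]"
    proof (rule nth_equalityI)
      fix r assume "r < length (u @ [c])"
      then show "(u @ [c]) ! r = w [q \<rightarrow> q + length (u @ [c])] ! r"
        using q ur by (cases "r = length u") (auto simp: nth_append)
    qed (simp add: subsequence_length)
    then show ?case
      unfolding factor_iff by blast
  qed
  moreover have "x \<in> lists (range w)" if "x \<in> factors w" for x
    using that by (force simp: factors_def factors_of_length_def subsequence_def)
  ultimately show ?thesis
    unfolding universal_def by blast
qed

section \<open>Iterated action of a permutation on words\<close>

text \<open>Following a letter forward along \<open>g\<close> cancels the \<open>inv g\<close> in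
  \<open>perm_word\<close>; this form fits the condition on the cycle.\<close>

lemma perm_word_nth:
  assumes "g permutes {1..int (length x)}" "t \<in> {1..int (length x)}"
  shows "perm_word g x ! nat (g t - 1) = x ! nat (t - 1)"
proof -
  have "g t \<in> {1..int (length x)}"
    using assms by (simp add: permutes_in_image del: atLeastAtMost_iff)
  then show ?thesis
    using assms(1) by (simp add: perm_word_def permutes_inverses nth_upto nat_less_iff)
qed

lemma length_perm_word [simp]: "length (perm_word g x) = length x"
  by (simp add: perm_word_def)

lemma length_perm_word_funpow [simp]: "length ((perm_word g ^^ s) x) = length x"
  by (induction s) auto

lemma perm_word_funpow_nth:
  assumes "g permutes {1..int (length x)}" "t \<in> {1..int (length x)}"
  shows "(perm_word g ^^ s) x ! nat ((g ^^ s) t - 1) = x ! nat (t - 1)"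
proof (induction s)
  case (Suc s)
  have "(g ^^ s) t \<in> {1..int (length x)}"
    by (induction s) (use assms in \<open>simp_all add: permutes_in_image del: atLeastAtMost_iff\<close>)
  then show ?case
    using Suc perm_word_nth[of g "(perm_word g ^^ s) x" "(g ^^ s) t"] assms(1) by simp
qed auto

lemma perm_word_funpow_in:
  assumes "g \<in> symmetry_group n w" "x \<in> factors_of_length n w"
  shows "(perm_word g ^^ s) x \<in> factors_of_length n w"
  by (induction s) (use assms in \<open>auto simp: symmetry_group_def\<close>)

lemma cycle_funpow:
  assumes "\<forall>l<length js. g (i + js ! l) = i + js ! (Suc l mod length js)" "l < length js"
  shows "(g ^^ s) (i + js ! l) = i + js ! ((l + s) mod length js)"
proof (induction s)
  case (Suc s)
  have "(l + s) mod length js < length js"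
    using assms(2) by (intro mod_less_divisor) auto
  then show ?case
    using Suc assms(1) by (simp add: mod_Suc_eq)
qed (use assms in auto)

section \<open>From the cycle to skippable gaps and universality\<close>

text \<open>Some power of \<beta> sends \<open>i k + j\<close> to \<open>i k + Min (set js)\<close>
  and fixes all earlier positions. It thus moves a letter across the gap and leaves the prefix
  intact.\<close>

lemma skippable_cycle_entry:
  fixes js :: "int list" and n :: "nat \<Rightarrow> nat" and i :: "nat \<Rightarrow> int"
  assumes rec: "recurrent w" and j: "j \<in> set js" and mono: "strict_mono i"
    and range: "\<forall>k. \<forall>j \<in> set js. i k + j \<in> {1..int (n k)}"
    and sym: "\<forall>k. \<exists>\<beta> \<in> symmetry_group (n k) w.
           (\<forall>l < length js. \<beta> (i k + js ! l) = i k + js ! (Suc l mod length js)) \<and>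
           (\<forall>t \<in> {1..i k + Min (set js) - 1}. \<beta> t = t)"
  shows "skippable w (nat (j - Min (set js)))"
  unfolding skippable_def
proof (intro allI)
  fix p L
  define m where "m = Min (set js)"
  define d where "d = nat (j - m)"
  have m: "m \<in> set js" and "m \<le> j"
    using j by (auto simp: m_def intro!: Min_in)
  then have d: "int d = j - m"
    by (simp add: d_def)
  obtain l l0 where l: "l < length js" "js ! l = j" and l0: "l0 < length js" "js ! l0 = m"
    using j m by (metis in_set_conv_nth)
  \<comment> \<open>A strictly increasing integer sequence is unbounded, so the fixed initial
    stretch can be made at least \<open>L\<close> long, even if \<open>i 0\<close> is
    negative.\<close>
  have "i 0 + int k \<le> i k" for k
  proof (induction k)
    case (Suc k)
    then show ?case
      using strict_monoD[OF mono, of k "Suc k"] by simp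
  qed simp
  from this[of "nat (int L + 1 - m - i 0)"] obtain k where k: "i k + m - 1 \<ge> int L"
    by (smt (verit) nat_0_le int_nat_eq)
  \<comment> \<open>The positions \<open>1\<close> to \<open>A\<close> are those before the least
    position of the cycle, which therefore has list index \<open>A\<close>.\<close>
  define A where "A = nat (i k + m - 1)"
  have A: "int A = i k + m - 1" "A \<ge> L"
    using k by (auto simp: A_def)
  have An: "A + d < n k"
    using range[rule_format, OF j, of k] A d by simp
  obtain \<beta> where \<beta>: "\<beta> \<in> symmetry_group (n k) w"
    and cyc: "\<forall>l < length js. \<beta> (i k + js ! l) = i k + js ! (Suc l mod length js)"
    and fixed: "\<And>t. t \<in> {1..int A} \<Longrightarrow> \<beta> t = t"
    using sym A unfolding m_def by metis
  have perm: "\<beta> permutes {1..int (n k)}"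
    using \<beta> by (simp add: symmetry_group_def)
  \<comment> \<open>A late occurrence leaves room for a left extension by \<open>A - L\<close>
    letters.\<close>
  obtain p' where p': "p' \<ge> A" "\<And>r. r < L + d + 1 \<Longrightarrow> w (p' + r) = w (p + r)"
    using recurrentD[OF rec] by blast
  \<comment> \<open>In this window the prefix fills the list indices \<open>A - L\<close> to
    \<open>A - 1\<close>, and the letter behind the gap has index \<open>A + d\<close>, that is,
    position \<open>i k + j\<close>.\<close>
  define x where "x = w [p' + L - A \<rightarrow> p' + L - A + n k]"
  have x: "x \<in> factors_of_length (n k) w" and [simp]: "length x = n k"
    by (auto simp: x_def factors_of_length_def subsequence_length)
  have xn: "x ! r = w (p' + L - A + r)" if "r < n k" for r
    using that by (simp add: x_def)
  \<comment> \<open>This shifts the index \<open>l\<close> to \<open>l0\<close> modulo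
    \<open>length js\<close>; the added \<open>length js\<close> keeps the subtraction from
    truncating.\<close>
  define s where "s = l0 + length js - l"
  define y where "y = (perm_word \<beta> ^^ s) x"
  have "y \<in> factors_of_length (n k) w"
    unfolding y_def by (rule perm_word_funpow_in[OF \<beta> x])
  then obtain q where q: "y = w [q \<rightarrow> q + n k]"
    by (auto simp: factors_of_length_def)
  have yn: "y ! r = w (q + r)" if "r < n k" for r
    using that by (simp add: q)
  have move: "y ! nat ((\<beta> ^^ s) t - 1) = x ! nat (t - 1)" if "t \<in> {1..int (n k)}" for t
    unfolding y_def using perm_word_funpow_nth[of \<beta> x t s] perm that by simp
  have prefix: "y ! r = x ! r" if "r < A" for r
  proof -
    have "(\<beta> ^^ s) (int r + 1) = int r + 1"
      by (induction s) (use fixed that in auto)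
    then show ?thesis
      using move[of "int r + 1"] that An by simp
  qed
  have "(l + s) mod length js = l0"
    using l(1) l0(1) by (simp add: s_def)
  then have "(\<beta> ^^ s) (i k + j) = i k + m"
    using cycle_funpow[OF cyc l(1), of s] l l0 by simp
  moreover have "nat (i k + m - 1) = A" "nat (i k + j - 1) = A + d"
    using A d by auto
  \<comment> \<open>The letter behind the gap lands directly after the unchanged prefix.\<close>
  ultimately have yA: "y ! A = x ! (A + d)"
    using move[of "i k + j"] range j by (simp del: atLeastAtMost_iff)
  \<comment> \<open>Starting at \<open>q + (A - L)\<close> discards the left extension.\<close>
  have "w (q + (A - L) + r) = w (p + r)" if "r < L" for r
  proof -
    have "w (q + (A - L + r)) = x ! (A - L + r)"
      using that A An prefix[of "A - L + r"] yn[of "A - L + r"] by simp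
    also have "\<dots> = w (p' + r)"
      using that A An p'(1) by (subst xn) auto
    finally show ?thesis
      using that p'(2)[of r] by (simp add: add.assoc)
  qed
  moreover have "w (q + (A - L) + L) = w (p + L + d)"
  proof -
    have "w (q + A) = w (p' + (L + d))"
      using yA An p'(1) yn[of A] xn[of "A + d"] by (simp add: add.assoc)
    also have "\<dots> = w (p + (L + d))"
      by (rule p'(2)) simp
    finally show ?thesis
      using A by (simp add: add.assoc)
  qed
  ultimately show "\<exists>q. (\<forall>r<L. w (q + r) = w (p + r)) \<and> w (q + L) = w (p + L + nat (j - Min (set js)))"
    unfolding d_def m_def by blast
qed

theorem proposition5:
  fixes w :: "'a word"
    and js :: "int list"
    and n :: "nat \<Rightarrow> nat"
    and i :: "nat \<Rightarrow> int"
  assumes "finite (range w)"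
    and "recurrent w"
    and "js \<noteq> []"
    and "distinct js"
    and "\<forall>j \<in> set js. 0 < j"
    and "\<not> arithmetical js"
    and "strict_mono n"
    and "strict_mono i"
    and "\<forall>k. \<forall>j \<in> set js. i k + j \<in> {1..int (n k)}"
    and "\<forall>k. \<exists>\<beta> \<in> symmetry_group (n k) w.
           (\<forall>l < length js. \<beta> (i k + js ! l) = i k + js ! (Suc l mod length js)) \<and>
           (\<forall>t \<in> {1..i k + Min (set js) - 1}. \<beta> t = t)"
  shows "universal w"
proof -
  have "\<exists>N. \<forall>e\<ge>N. e \<in> {e. skippable w e}"
  proof (rule numerical_semigroup_cofinite)
    fix g :: nat
    assume g: "\<And>a. a \<in> {e. skippable w e} \<Longrightarrow> g dvd a"
    have dvd: "int g dvd j - Min (set js)" if "j \<in> set js" for j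
    proof -
      have "g dvd nat (j - Min (set js))"
        using g skippable_cycle_entry[OF assms(2) that assms(8-10)] by simp
      then show ?thesis
        using that by (simp add: int_dvd_int_iff[symmetric] del: int_dvd_int_iff)
    qed
    \<comment> \<open>All entries agree with the minimum modulo any divisor of
      \<open>g\<close>.\<close>
    have arith: "arithmetical js" if "l \<ge> 2" "l dvd int g" for l :: int
    proof -
      have "[x = y] (mod l)" if "x \<in> set js" "y \<in> set js" for x y
      proof -
        have "l dvd (x - Min (set js)) - (y - Min (set js))"
          using dvd that \<open>l dvd int g\<close> by (blast intro: dvd_diff dvd_trans)
        then show ?thesis
          by (simp add: cong_iff_dvd_diff)
      qed
      then show ?thesis
        using \<open>l \<ge> 2\<close> unfolding arithmetical_def by blast
    qed
    show "g = 1"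
    proof (rule ccontr)
      assume "g \<noteq> 1"
      \<comment> \<open>For \<open>g = 0\<close> the modulus 2 serves, as it divides 0; otherwise
        \<open>g\<close> itself does.\<close>
      then consider "g = 0" | "g \<ge> 2" by linarith
      then show False
        using arith[of 2] arith[of "int g"] assms(6) by cases auto
    qed
  qed (auto intro: skippable_0 skippable_add)
  then show ?thesis
    using universal_if_skippable[OF assms(2)] by auto
qed

end
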